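(* Let $d$ be a positive integer with $d\equiv 9\pmod{16}$. Then the equation $x^2-2dy^2=2$ has no solution $(x,y)\in\mathbb{Z}^2$. *)

theory Defs
  imports "HOL-Number_Theory.Number_Theory"
begin

end

theory Submission
  imports Defs
begin

text \<open>
  In a solution \<open>x\<close> is even, and \<open>x = 2 * z\<close> turns the equation into
  \<open>2 * z\<^sup>2 - 1 = d * y\<^sup>2\<close>. Hence 2 is a square modulo \<open>\<bar>y\<bar>\<close>, which forces \<open>y\<close> to be
  congruent to 1 or -1 modulo 8 (lemma \<open>dvd_two_square_minus_one_mod_8\<close>), so that
  \<open>y\<^sup>2\<close> is 1 modulo 16. As \<open>d\<close> is 9 modulo 16, this gives
  \<open>2 * z\<^sup>2\<close> congruent to 10 modulo 16, that is, \<open>z\<^sup>2\<close> congruent to 5 modulo 8,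
  and 5 is not a square modulo 8.

  The condition on \<open>y\<close> could be read off from the supplementary law for the quadratic
  character of 2, applied to each prime factor of \<open>y\<close>. A descent proves it for all
  divisors at once, without primes.
\<close>

lemma square_mod_8:
  fixes z :: int
  shows "z\<^sup>2 mod 8 \<in> {0, 1, 4}"
proof -
  have "z mod 8 \<in> {0, 1, 2, 3, 4, 5, 6, 7}"
    by simp presburger
  moreover have "z\<^sup>2 mod 8 = (z mod 8)\<^sup>2 mod 8"
    by (simp add: power_mod)
  ultimately show ?thesis
    by auto
qed

text \<open>
  Descent on the divisor: only \<open>z\<^sup>2\<close> modulo \<open>n\<close> matters, so \<open>z\<close> can be replaced by
  some \<open>w\<close> congruent to \<open>z\<close> or \<open>- z\<close> with \<open>0 \<le> 2 * w \<le> n\<close>. Unless \<open>w = 0\<close>, when \<open>n\<close>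
  divides 1, the cofactor \<open>m\<close> in \<open>2 * w\<^sup>2 - 1 = n * m\<close> is positive, smaller than \<open>n\<close>,
  and itself a divisor of a number of this form. The product \<open>n * m\<close> is 1 or -1
  modulo 8, because the squares modulo 8 are 0, 1 and 4, and so is \<open>m\<close> by induction;
  therefore \<open>n\<close> is as well.
\<close>

lemma dvd_two_square_minus_one_mod_8:
  fixes n z :: int
  assumes "n > 0" and "n dvd 2 * z\<^sup>2 - 1"
  shows "n mod 8 \<in> {1, 7}"
  using assms
proof (induction "nat n" arbitrary: n z rule: less_induct)
  case less
  define w where "w = min (z mod n) (n - z mod n)"
  have "0 \<le> w" "2 * w \<le> n"
    using \<open>n > 0\<close> by (auto simp: w_def min_def less_imp_le)
  have "n dvd z - w \<or> n dvd z + w"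
  proof (cases "w = z mod n")
    case True
    then show ?thesis
      by (simp add: dvd_minus_mod)
  next
    case False
    then have "z + w = (z - z mod n) + n"
      by (auto simp: w_def min_def split: if_splits)
    then show ?thesis
      by (metis dvd_add dvd_minus_mod dvd_refl)
  qed
  then have "n dvd (z - w) * (z + w)"
    by (auto intro: dvd_mult dvd_mult2)
  then have "n dvd (2 * z\<^sup>2 - 1) - 2 * ((z - w) * (z + w))"
    by (rule dvd_diff[OF less.prems(2) dvd_mult])
  also have "(2 * z\<^sup>2 - 1) - 2 * ((z - w) * (z + w)) = 2 * w\<^sup>2 - 1"
    by (simp add: algebra_simps power2_eq_square)
  finally obtain m where m: "2 * w\<^sup>2 - 1 = n * m"
    by (elim dvdE)
  show ?case
  proof (cases "w = 0")
    case True
    then have "n dvd 1"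
      using m by (metis dvd_minus_iff dvd_triv_left diff_0 mult_zero_right zero_power2)
    then show ?thesis
      using \<open>n > 0\<close> by simp
  next
    case False
    then have "w\<^sup>2 \<ge> 1"
      by (simp add: int_one_le_iff_zero_less)
    then have "n * m > 0"
      using m by linarith
    then have "m > 0"
      using \<open>n > 0\<close> by (simp add: zero_less_mult_iff)
    have "(2 * w)\<^sup>2 \<le> n\<^sup>2"
      using \<open>0 \<le> w\<close> \<open>2 * w \<le> n\<close> by (intro power_mono) auto
    then have "2 * w\<^sup>2 - 1 < n\<^sup>2"
      using \<open>w\<^sup>2 \<ge> 1\<close> by (simp add: power_mult_distrib)
    then have "n * m < n * n"
      using m by (simp add: power2_eq_square)
    then have "m < n"
      using \<open>n > 0\<close> by simp
    have "m dvd 2 * w\<^sup>2 - 1"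
      using m by simp
    then have m_mod: "m mod 8 \<in> {1, 7}"
      using less.hyps[of m w] \<open>m > 0\<close> \<open>m < n\<close> by simp
    have "(2 * w\<^sup>2 - 1) mod 8 = (2 * (w\<^sup>2 mod 8) - 1) mod 8"
      by (metis mod_diff_left_eq mod_mult_right_eq)
    then have "(2 * w\<^sup>2 - 1) mod 8 \<in> {1, 7}"
      using square_mod_8[of w] by auto
    with m have nm_mod: "(n mod 8) * (m mod 8) mod 8 \<in> {1, 7}"
      by (simp add: mod_mult_eq)
    have "n mod 8 \<in> {0, 1, 2, 3, 4, 5, 6, 7}"
      by simp presburger
    \<comment> \<open>1 and -1 are their own inverses modulo 8, so \<open>n\<close> is congruent to \<open>(n * m) * m\<close>.\<close>
    then show ?thesis
      using m_mod nm_mod by auto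
  qed
qed

theorem proposition3p2:
  fixes d :: int
  assumes "d > 0" and "[d = 9] (mod 16)"
  shows "\<not> (\<exists>x y :: int. x\<^sup>2 - 2 * d * y\<^sup>2 = 2)"
proof
  assume "\<exists>x y :: int. x\<^sup>2 - 2 * d * y\<^sup>2 = 2"
  then obtain x y :: int where xy: "x\<^sup>2 - 2 * d * y\<^sup>2 = 2"
    by blast
  then have "x\<^sup>2 = 2 * (d * y\<^sup>2 + 1)"
    by simp
  then have "even (x\<^sup>2)"
    by simp
  then obtain z where "x = 2 * z"
    by (auto elim: evenE)
  with xy have z: "2 * z\<^sup>2 - 1 = d * y\<^sup>2"
    by (simp add: power_mult_distrib)
  have "y \<noteq> 0"
  proof
    assume "y = 0"
    with z have "2 * z\<^sup>2 = 1"
      by simp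
    then show False
      by presburger
  qed
  have "\<bar>y\<bar> dvd 2 * z\<^sup>2 - 1"
    unfolding z by (simp add: power2_eq_square)
  then have y_mod: "\<bar>y\<bar> mod 8 \<in> {1, 7}"
    using \<open>y \<noteq> 0\<close> by (intro dvd_two_square_minus_one_mod_8) auto
  define k where "k = \<bar>y\<bar> div 8"
  have "\<bar>y\<bar> = 8 * k + \<bar>y\<bar> mod 8"
    by (simp add: k_def)
  with y_mod have "\<bar>y\<bar> = 8 * k + 1 \<or> \<bar>y\<bar> = 8 * k + 7"
    by auto
  then have "\<bar>y\<bar>\<^sup>2 - 1 = 16 * (4 * k\<^sup>2 + k) \<or> \<bar>y\<bar>\<^sup>2 - 1 = 16 * (4 * k\<^sup>2 + 7 * k + 3)"
    by (elim disjE) (simp_all add: power2_eq_square algebra_simps)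
  then have "16 dvd y\<^sup>2 - 1"
    by (metis dvd_triv_left power2_abs)
  then have "[y\<^sup>2 = 1] (mod 16)"
    by (simp add: cong_iff_dvd_diff)
  with assms(2) have "[d * y\<^sup>2 = 9 * 1] (mod 16)"
    by (rule cong_mult)
  then have "(d * y\<^sup>2) mod 16 = 9"
    by (simp add: cong_def)
  then have "z\<^sup>2 mod 8 = 5"
    using z by presburger
  then show False
    using square_mod_8[of z] by simp
qed

end
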